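(* Let $I$ be a MOMILP instance, let $\varepsilon\in\mathbb{R}_{>0}$, let $\mathsf{hpO}$ be a plane separating oracle for $I$, and let $x^{\mathrm{init}}\in X$ be a feasible solution with encoding length in $\mathcal{O}(\mathsf{poly}(\langle I\rangle))$. Then the set $R$ computed by the inner approximation algorithm described in the context (run with $I$, $x^{\mathrm{init}}$, $\varepsilon$ and $\mathsf{hpO}$) is a $(1+\varepsilon)$-convex approximation set.
   Context: MOMILP. For $d,m,n\in\mathbb{N}_{>0}$, $Q\in\mathbb{Q}^{d\times n}$, $A\in\mathbb{Q}^{m\times n}$, $b\in\mathbb{Q}^m$ and $n_{\mathbb{R}},n_{\mathbb{Z}}\in\mathbb{N}_{\ge 0}$ with $n_{\mathbb{R}}+n_{\mathbb{Z}}=n$, a multi-objective mixed-integer linear program (MOMILP) is the problem $\min f(x)=Qx$ subject to $Ax\ge b$, $x\in\mathbb{R}^{n_{\mathbb{R}}}\times\mathbb{Z}^{n_{\mathbb{Z}}}$. $X$ denotes its set of feasible solutions and $Y=\{f(x):x\in X\}\subseteq\mathbb{R}^d$ its set of images. An instance $I$ need not be explicitly encoded in this form. Standing assumptions: $X\ne\emptyset$, $Y\subseteq\mathbb{R}^d_{\ge 0}$, and the number $d$ of objectives is a constant. $\langle\cdot\rangle$ denotes binary encoding length; inequalities between vectors are componentwise; sums of sets are Minkowski sums; $\mathsf{conv}$ is the convex hull. Convex approximation set. A set $R\subseteq X$ is a $(1+\varepsilon)$-convex approximation set if for each $x\in X$ there is $v\in\mathsf{conv}\{f(x^* ):x^*\in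 R\}$ with $v\le(1+\varepsilon)f(x)$. Plane separating oracle. A plane separating oracle $\mathsf{hpO}$ for $I$ is a black-box algorithm that takes a halfspace $H=\{z\in\mathbb{R}^d:w^{\mathsf T}z\ge c\}$ with $w\in\mathbb{R}^d_{\ge0}$ and returns either $(\textit{inside},\emptyset)$, in which case $f(x)\in H$ for all $x\in X$, or $(\textit{not inside},x)$ where $x\in X$, $\langle x\rangle\in\mathcal{O}(\mathsf{poly}(\langle I\rangle))$ and $f(x)\notin H$. Facet-supporting halfspaces. For a polyhedron $\mathcal{P}$, $\mathcal{H}(\mathcal{P})$ is the set of halfspaces that contain $\mathcal{P}$ and whose boundary contains a facet of $\mathcal{P}$. Inner approximation algorithm. Initialize $R=\{x^{\mathrm{init}}\}$, $k=1$, $F=\emptyset$, $\mathcal{A}^{(1)}=\{f(x^{\mathrm{init}})\}+\mathbb{R}^d_{\ge0}$. While $\mathcal{H}(\mathcal{A}^{(k)})\setminus F\ne\emptyset$: pick an arbitrary halfspace $H=\{z\in\mathbb{R}^d:w^{\mathsf T}z\ge c\}\in\mathcal{H}(\mathcal{A}^{(k)})\setminus F$; set $H_{1+\varepsilon}=\{z\in\mathbb{R}^d:(1+\varepsilon)w^{\mathsf T}z\ge c\}$; call $\mathsf{hpO}(H_{1+\varepsilon})$. If it returns $(\textit{not inside},x^* )$, set $R\gets R\cup\{x^*\}$, $k\gets k+1$, $\mathcal{A}^{(k)}\gets\mathsf{conv}\{f(x):x\in R\}+\mathbb{R}^d_{\ge0}$; otherwise set $F\gets F\cup\{H\}$. The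 set computed by the algorithm is $R$ at termination, and $\mathcal{A}$ denotes the final $\mathcal{A}^{(k)}$. *)

theory Defs
  imports "HOL-Analysis.Analysis" "HOL-Computational_Algebra.Polynomial"
begin

section \<open>Multi-objective mixed-integer linear programs\<close>

text \<open>
  The dimensions \<open>d\<close>, \<open>m\<close>, \<open>n\<close> are the cardinalities of the index types \<open>'d\<close>, \<open>'m\<close>, \<open>'n\<close>.
  The set \<open>int_vars\<close> consists of the indices of the integer variables, so its cardinality is the
  number of integer variables and that of its complement the number of continuous ones; either
  set may be empty.  The encoding length of the instance is a separate component, because an
  instance may be given by an encoding other than an explicit list of its coefficients.
\<close>

record ('d, 'm, 'n) momilp =
  obj :: "rat ^ 'n::finite ^ 'd::finite"
  lhs :: "rat ^ 'n::finite ^ 'm::finite"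
  rhs :: "rat ^ 'm::finite"
  int_vars :: "'n::finite set"
  inst_length :: nat

definition objective ::
    "('d::finite, 'm::finite, 'n::finite) momilp \<Rightarrow> real ^ 'n \<Rightarrow> real ^ 'd" where
  "objective I x = map_matrix of_rat (obj I) *v x"

definition feasible_set ::
    "('d::finite, 'm::finite, 'n::finite) momilp \<Rightarrow> (real ^ 'n) set" where
  "feasible_set I =
     {x. (\<chi> i. of_rat (rhs I $ i)) \<le> map_matrix of_rat (lhs I) *v x \<and>
         (\<forall>j\<in>int_vars I. x $ j \<in> \<int>)}"

definition image_set ::
    "('d::finite, 'm::finite, 'n::finite) momilp \<Rightarrow> (real ^ 'd) set" where
  "image_set I = objective I ` feasible_set I"

definition convex_approx_set ::
    "('d::finite, 'm::finite, 'n::finite) momilp \<Rightarrow> real \<Rightarrow> (real ^ 'n) set \<Rightarrow> bool" where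
  "convex_approx_set I \<epsilon> R \<longleftrightarrow>
     R \<subseteq> feasible_set I \<and>
     (\<forall>x\<in>feasible_set I. \<exists>v\<in>convex hull (objective I ` R). v \<le> (1 + \<epsilon>) *\<^sub>R objective I x)"


section \<open>Binary encoding length of solutions\<close>

text \<open>A sign bit plus the binary digits of the absolute value.\<close>

definition int_length :: "int \<Rightarrow> nat" where
  "int_length k = 1 + nat \<lceil>log 2 (real_of_int \<bar>k\<bar> + 1)\<rceil>"

definition rat_length :: "rat \<Rightarrow> nat" where
  "rat_length r = int_length (fst (quotient_of r)) + int_length (snd (quotient_of r))"

definition vec_length :: "rat ^ 'n::finite \<Rightarrow> nat" where
  "vec_length q = (\<Sum>j\<in>UNIV. rat_length (q $ j))"

text \<open>Only rational vectors have an encoding.\<close>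

definition encoded_within :: "real ^ 'n::finite \<Rightarrow> nat \<Rightarrow> bool" where
  "encoded_within x L \<longleftrightarrow> (\<exists>q. x = (\<chi> j. of_rat (q $ j)) \<and> vec_length q \<le> L)"


section \<open>Halfspaces and plane separating oracles\<close>

abbreviation halfspace :: "real ^ 'd::finite \<Rightarrow> real \<Rightarrow> (real ^ 'd) set" where
  "halfspace w c \<equiv> {z. w \<bullet> z \<ge> c}"

definition facet_halfspaces :: "(real ^ 'd::finite) set \<Rightarrow> (real ^ 'd) set set" where
  "facet_halfspaces P =
     {H. (\<exists>w c. w \<noteq> 0 \<and> H = halfspace w c) \<and> P \<subseteq> H \<and>
         (\<exists>F. F facet_of P \<and> F \<subseteq> frontier H)}"

datatype 'n answer = Inside | Not_Inside "real ^ 'n::finite"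

text \<open>
  The polynomial \<open>p\<close> bounds the encoding length of the solutions that the oracle returns in terms
  of the encoding length of the instance.
\<close>

definition plane_separating_oracle ::
    "nat poly \<Rightarrow> ('d::finite, 'm::finite, 'n::finite) momilp \<Rightarrow>
     ((real ^ 'd) set \<Rightarrow> 'n answer) \<Rightarrow> bool" where
  "plane_separating_oracle p I hpO \<longleftrightarrow>
     (\<forall>w c. w \<noteq> 0 \<longrightarrow> 0 \<le> w \<longrightarrow>
        (case hpO (halfspace w c) of
           Inside \<Rightarrow> \<forall>x\<in>feasible_set I. objective I x \<in> halfspace w c
         | Not_Inside x \<Rightarrow> x \<in> feasible_set I \<and> encoded_within x (poly p (inst_length I)) \<and>
             objective I x \<notin> halfspace w c))"


section \<open>The inner approximation algorithm\<close>

text \<open>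
  A state consists of the set \<open>R\<close> of solutions, the current inner approximation \<open>A\<close>, and the set
  \<open>F\<close> of halfspaces that are already confirmed.  The picks of the algorithm are arbitrary, so one
  pass through its loop is a relation on states; it is not applicable when the loop condition
  fails.
\<close>

type_synonym ('d, 'n) state = "(real ^ 'n) set \<times> (real ^ 'd) set \<times> (real ^ 'd) set set"

definition ia_init ::
    "('d::finite, 'm::finite, 'n::finite) momilp \<Rightarrow> real ^ 'n \<Rightarrow> ('d, 'n) state" where
  "ia_init I xinit = ({xinit}, {objective I xinit} + {0..}, {})"

inductive ia_step ::
    "('d::finite, 'm::finite, 'n::finite) momilp \<Rightarrow> real \<Rightarrow> ((real ^ 'd) set \<Rightarrow> 'n answer) \<Rightarrow>
     ('d, 'n) state \<Rightarrow> ('d, 'n) state \<Rightarrow> bool"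
  for I \<epsilon> hpO where
  add_solution:
    "ia_step I \<epsilon> hpO (R, A, F)
       (insert x R, convex hull (objective I ` insert x R) + {0..}, F)"
    if "w \<noteq> 0" "halfspace w c \<in> facet_halfspaces A - F"
       "hpO (halfspace ((1 + \<epsilon>) *\<^sub>R w) c) = Not_Inside x"
| confirm_halfspace:
    "ia_step I \<epsilon> hpO (R, A, F) (R, A, insert (halfspace w c) F)"
    if "w \<noteq> 0" "halfspace w c \<in> facet_halfspaces A - F"
       "hpO (halfspace ((1 + \<epsilon>) *\<^sub>R w) c) = Inside"

definition ia_terminates ::
    "('d::finite, 'm::finite, 'n::finite) momilp \<Rightarrow> real \<Rightarrow> ((real ^ 'd) set \<Rightarrow> 'n answer) \<Rightarrow>
     real ^ 'n \<Rightarrow> bool" where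
  "ia_terminates I \<epsilon> hpO xinit \<longleftrightarrow>
     \<not> (\<exists>s. s 0 = ia_init I xinit \<and> (\<forall>i::nat. ia_step I \<epsilon> hpO (s i) (s (Suc i))))"

definition ia_computes ::
    "('d::finite, 'm::finite, 'n::finite) momilp \<Rightarrow> real \<Rightarrow> ((real ^ 'd) set \<Rightarrow> 'n answer) \<Rightarrow>
     real ^ 'n \<Rightarrow> (real ^ 'n) set \<Rightarrow> bool" where
  "ia_computes I \<epsilon> hpO xinit R \<longleftrightarrow>
     (\<exists>A F. (ia_step I \<epsilon> hpO)\<^sup>*\<^sup>* (ia_init I xinit) (R, A, F) \<and> facet_halfspaces A - F = {})"

end

theory Submission
  imports Defs
begin

text \<open>
  Let \<open>f\<close> be the objective map and \<open>A = convex hull (f ` R) + {0..}\<close> the inner approximation for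
  the current set \<open>R\<close> of solutions.
  It is a polyhedron, because it is the sum of a polytope and a finitely generated cone
  (\<open>polyhedron_convex_hull_plus_cone_hull\<close>), and it is full-dimensional.  Therefore \<open>A\<close> is the
  intersection of its facet-supporting halfspaces (\<open>Inter_facet_halfspaces_subset\<close>), and there are
  only finitely many of them (\<open>finite_facet_halfspaces\<close>).  Since \<open>A\<close> is upward closed, their
  normals are nonnegative, so the oracle's guarantee applies to every query of the algorithm.

  \<^bold>\<open>Approximation.\<close>  A halfspace \<open>w \<bullet> z \<ge> c\<close> is confirmed only if \<open>c \<le> w \<bullet> ((1 + \<epsilon>) *\<^sub>R f x)\<close>
  for every feasible \<open>x\<close>, that is, if it contains \<open>(1 + \<epsilon>) *\<^sub>R f x\<close>.  Once all facets are confirmed,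
  the point \<open>(1 + \<epsilon>) *\<^sub>R f x\<close> lies in their intersection, hence in \<open>A\<close>; by the definition of \<open>A\<close>
  it then dominates some point of \<open>convex hull (f ` R)\<close>.

  \<^bold>\<open>Termination.\<close>  A solution \<open>x\<close> returned for the halfspace \<open>w \<bullet> z \<ge> c\<close> satisfies
  \<open>w \<bullet> f x \<le> (1 + \<epsilon>) * (w \<bullet> f x) < c\<close>, where the first inequality uses that both \<open>w\<close> and the
  image \<open>f x\<close> are nonnegative.  So \<open>f x\<close> is outside \<open>A\<close>, and \<open>x\<close> is not in \<open>R\<close>.  All members of
  \<open>R\<close> are encoded within a fixed length, and only finitely many points are; so \<open>R\<close> grows only
  finitely often.  Between two such growths each pass confirms a new one of finitely many facets.
\<close>

section \<open>Polytope plus finitely generated cone\<close>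

lemma polyhedron_slice:
  fixes C :: "(real \<times> 'a::euclidean_space) set"
  assumes "polyhedron C"
  shows "polyhedron {z. (t, z) \<in> C}"
proof -
  obtain F where F: "finite F" "C = \<Inter>F"
      "\<And>h. h \<in> F \<Longrightarrow> \<exists>a b. a \<noteq> 0 \<and> h = {x. a \<bullet> x \<le> b}"
    using assms unfolding polyhedron_def by auto
  have "polyhedron {z. (t, z) \<in> h}" if "h \<in> F" for h
  proof -
    obtain a b where h: "h = {x. a \<bullet> x \<le> b}"
      using F(3) \<open>h \<in> F\<close> by blast
    have "{z. (t, z) \<in> h} = {z. snd a \<bullet> z \<le> b - fst a * t}"
      unfolding h by (simp add: inner_prod_def le_diff_eq add.commute)
    then show ?thesis
      by (simp only: polyhedron_halfspace_le)
  qed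
  then have "polyhedron (\<Inter>((\<lambda>h. {z. (t, z) \<in> h}) ` F))"
    using F(1) by (intro polyhedron_Inter) auto
  moreover have "{z. (t, z) \<in> C} = \<Inter>((\<lambda>h. {z. (t, z) \<in> h}) ` F)"
    using F(2) by auto
  ultimately show ?thesis
    by (simp only:)
qed

text \<open>
  Homogenization: with the points of \<open>V\<close> lifted to height 1 and the directions of \<open>W\<close> to height 0,
  the set is the slice at height 1 of a finitely generated cone, and such cones are polyhedra.
\<close>

lemma polyhedron_convex_hull_plus_cone_hull:
  fixes V W :: "'a::euclidean_space set"
  assumes "finite V" "finite W"
  shows "polyhedron (convex hull V + convex_cone hull W)"
proof (cases "V = {}")
  case True
  then show ?thesis
    by simp
next
  case False
  let ?V = "{1::real} \<times> V" and ?W = "{0::real} \<times> W"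
  define C where "C = convex_cone hull (?V \<union> ?W)"
  have coneV: "convex_cone hull ?V = conic hull ({1::real} \<times> (convex hull V))"
    using False by (simp add: convex_cone_hull_separate_nonempty convex_hull_Times)
  have W: "?W = Pair 0 ` W"
    by auto
  have "linear (Pair (0::real) :: 'a \<Rightarrow> _)"
    by (auto intro!: linearI)
  then have coneW: "convex_cone hull ?W = Pair 0 ` (convex_cone hull W)"
    unfolding W by (rule convex_cone_hull_linear_image)
  have "C = convex_cone hull ?V + convex_cone hull ?W"
    unfolding C_def convex_cone_hull_Un by (auto simp: set_plus_def)
  then have C: "C = conic hull ({1::real} \<times> (convex hull V)) + Pair 0 ` (convex_cone hull W)"
    unfolding coneV coneW .
  have "(1, z) \<in> C \<longleftrightarrow> z \<in> convex hull V + convex_cone hull W" for z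
  proof
    assume "(1, z) \<in> C"
    then obtain p q where z: "(1::real, z) = p + q"
        and p: "p \<in> conic hull ({1::real} \<times> (convex hull V))"
        and q: "q \<in> Pair 0 ` (convex_cone hull W)"
      unfolding C by (rule set_plus_elim)
    obtain s v where sv: "p = (s, s *\<^sub>R v)" "v \<in> convex hull V"
      using p unfolding conic_hull_explicit by auto
    obtain u where u: "q = (0, u)" "u \<in> convex_cone hull W"
      using q by auto
    have "s = 1" "z = v + u"
      using z sv(1) u(1) by auto
    then show "z \<in> convex hull V + convex_cone hull W"
      using sv(2) u(2) by (simp add: set_plus_intro)
  next
    assume "z \<in> convex hull V + convex_cone hull W"
    then obtain v u where z: "z = v + u" and v: "v \<in> convex hull V"
        and u: "u \<in> convex_cone hull W"
      by (rule set_plus_elim)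
    have "(1, v) + (0, u) \<in> C"
      unfolding C
    proof (rule set_plus_intro)
      show "(1, v) \<in> conic hull ({1} \<times> (convex hull V))"
        using v by (intro hull_inc) simp
    qed (use u in \<open>rule imageI\<close>)
    then show "(1, z) \<in> C"
      by (simp add: z)
  qed
  moreover have "polyhedron {z. (1, z) \<in> C}"
    unfolding C_def using assms
    by (intro polyhedron_slice[OF polyhedron_convex_cone_hull]) simp
  ultimately show ?thesis
    by simp
qed

lemma nonneg_orthant_eq_convex_cone_hull_Basis:
  "{0::'a::ordered_euclidean_space..} = convex_cone hull Basis"
proof
  show "{0..} \<subseteq> convex_cone hull (Basis :: 'a set)"
  proof
    fix x :: 'a assume "x \<in> {0..}"
    then have "0 \<le> x"
      by simp
    then have "0 \<le> x \<bullet> b" if "b \<in> Basis" for b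
      using that by (metis eucl_le inner_zero_left)
    then have mem: "(x \<bullet> b) *\<^sub>R b \<in> convex_cone hull Basis" if "b \<in> Basis" for b
      using that by (intro convex_cone_hull_mul hull_inc)
    have "(\<Sum>b\<in>B. (x \<bullet> b) *\<^sub>R b) \<in> convex_cone hull Basis" if "B \<subseteq> Basis" for B
      using that by (induction B rule: infinite_finite_induct)
        (simp_all add: convex_cone_hull_contains_0 convex_cone_hull_add mem)
    from this[OF subset_refl] show "x \<in> convex_cone hull Basis"
      by (simp only: euclidean_representation)
  qed
  show "convex_cone hull Basis \<subseteq> {0::'a..}"
  proof (rule hull_minimal)
    show "Basis \<subseteq> {0::'a..}"
      by (simp add: subset_iff eucl_le[where 'a = 'a] inner_Basis)
    show "convex_cone {0::'a..}"
      by (simp add: convex_cone_iff scaleR_nonneg_nonneg)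
  qed
qed

lemma polyhedron_convex_hull_plus_orthant:
  fixes V :: "'a::ordered_euclidean_space set"
  assumes "finite V"
  shows "polyhedron (convex hull V + {0..})"
  unfolding nonneg_orthant_eq_convex_cone_hull_Basis
  by (rule polyhedron_convex_hull_plus_cone_hull[OF assms finite_Basis])

lemma interior_plus_orthant_nonempty:
  fixes S :: "(real ^ 'd::finite) set"
  assumes "S \<noteq> {}"
  shows "interior (S + {0..}) \<noteq> {}"
proof -
  obtain s where s: "s \<in> S"
    using assms by blast
  have "box s (s + 1) \<subseteq> S + {0..}"
  proof
    fix y assume "y \<in> box s (s + 1)"
    then have "y - s \<in> {0..}"
      by (auto simp: mem_box_cart less_eq_vec_def intro: less_imp_le)
    then have "s + (y - s) \<in> S + {0..}"
      using s by (intro set_plus_intro)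
    then show "y \<in> S + {0..}"
      by simp
  qed
  then have "box s (s + 1) \<subseteq> interior (S + {0..})"
    by (simp add: interior_maximal open_box)
  moreover have "box s (s + 1) \<noteq> {}"
    by (simp add: interval_ne_empty_cart)
  ultimately show ?thesis
    by blast
qed

text \<open>
  A negative component of the normal would make \<open>w \<bullet> z\<close> unbounded below along the
  corresponding coordinate direction.
\<close>

lemma normal_nonneg_if_plus_orthant_subset_halfspace:
  fixes w :: "real ^ 'd::finite"
  assumes "S \<noteq> {}" and sub: "S + {0..} \<subseteq> halfspace w c"
  shows "0 \<le> w"
proof (rule ccontr)
  assume "\<not> 0 \<le> w"
  then obtain i where i: "w $ i < 0"
    by (auto simp: less_eq_vec_def not_le)
  obtain s where s: "s \<in> S"
    using assms by blast
  define t where "t = (\<bar>w \<bullet> s - c\<bar> + 1) / - (w $ i)"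
  have "t \<ge> 0"
    unfolding t_def using i by (intro divide_nonneg_pos) auto
  then have "axis i t \<in> {0..}"
    by (auto simp: less_eq_vec_def axis_def)
  then have "s + axis i t \<in> halfspace w c"
    using s sub by blast
  then have "c \<le> w \<bullet> s + w $ i * t"
    by (simp add: inner_add_right inner_axis)
  moreover have "w $ i * t = - (\<bar>w \<bullet> s - c\<bar> + 1)"
    unfolding t_def using i by (simp add: field_simps)
  ultimately show False
    by linarith
qed


section \<open>Facet-supporting halfspaces of a full-dimensional polyhedron\<close>

text \<open>
  In a minimal description of \<open>P\<close> by halfspaces every halfspace supports a facet; as the affine
  hull of \<open>P\<close> is the whole space, these halfspaces alone cut out \<open>P\<close>.
\<close>

lemma Inter_facet_halfspaces_subset:
  fixes P :: "(real ^ 'd::finite) set"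
  assumes "polyhedron P" "interior P \<noteq> {}"
  shows "\<Inter>(facet_halfspaces P) \<subseteq> P"
proof -
  have aff: "affine hull P = UNIV"
    using assms(2) by (rule affine_hull_nonempty_interior)
  obtain \<H> where fin: "finite \<H>" and seq: "P = affine hull P \<inter> \<Inter>\<H>"
      and "\<forall>h\<in>\<H>. \<exists>a b. a \<noteq> 0 \<and> h = {x. a \<bullet> x \<le> b}"
      and min: "\<And>\<H>'. \<H>' \<subset> \<H> \<Longrightarrow> P \<subset> affine hull P \<inter> \<Inter>\<H>'"
    using assms(1) unfolding polyhedron_Int_affine_minimal by blast
  then obtain a b where ab: "\<And>h. h \<in> \<H> \<Longrightarrow> a h \<noteq> 0 \<and> h = {x. a h \<bullet> x \<le> b h}"
    by metis
  have "h \<in> facet_halfspaces P" if h: "h \<in> \<H>" for h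
  proof -
    have "(P \<inter> {x. a h \<bullet> x = b h}) facet_of P"
      using facet_of_polyhedron_explicit[OF fin seq ab min] h by blast
    moreover have "frontier h = {x. a h \<bullet> x = b h}"
      using ab[OF h] frontier_halfspace_le[of "a h" "b h"] by metis
    moreover have "h = halfspace (- a h) (- b h)"
      using ab[OF h] by auto
    moreover have "P \<subseteq> h"
      using seq h by blast
    ultimately show ?thesis
      unfolding facet_halfspaces_def using ab[OF h] neg_equal_0_iff_equal by blast
  qed
  then show ?thesis
    using seq aff by blast
qed

lemma halfspace_subset_if_same_hyperplane:
  fixes w w' :: "real ^ 'd::finite"
  assumes eq: "{x. w \<bullet> x = c} = {x. w' \<bullet> x = c'}" and p: "c < w \<bullet> p" "c' < w' \<bullet> p"
  shows "halfspace w c \<subseteq> halfspace w' c'"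
proof (rule ccontr)
  assume "\<not> ?thesis"
  then obtain z where z: "c \<le> w \<bullet> z" "w' \<bullet> z < c'"
    by force
  \<comment> \<open>The segment from \<open>p\<close> to \<open>z\<close> crosses the second hyperplane at \<open>y\<close>, strictly before \<open>z\<close>;
      there \<open>w\<close> is a proper average of \<open>w \<bullet> p > c\<close> and \<open>w \<bullet> z \<ge> c\<close>, so \<open>y\<close> is off the first.\<close>
  define t where "t = (w' \<bullet> p - c') / (w' \<bullet> p - w' \<bullet> z)"
  define y where "y = (1 - t) *\<^sub>R p + t *\<^sub>R z"
  have t: "0 < t" "t < 1"
    using p z by (auto simp: t_def)
  have "t * (w' \<bullet> p - w' \<bullet> z) = w' \<bullet> p - c'"
    using p z by (simp add: t_def)
  then have "w' \<bullet> y = c'"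
    by (simp add: y_def inner_add_right algebra_simps)
  then have "w \<bullet> y = c"
    using eq by auto
  moreover have "(1 - t) * c < (1 - t) * (w \<bullet> p)" "t * c \<le> t * (w \<bullet> z)"
    using t p z by auto
  then have "c < w \<bullet> y"
    by (simp add: y_def inner_add_right algebra_simps)
  ultimately show False
    by simp
qed

text \<open>
  A facet \<open>F\<close> of a full-dimensional set spans the boundary hyperplane, and an interior point
  selects the side, so \<open>F\<close> determines its supporting halfspace.
\<close>

lemma facet_determines_halfspace:
  fixes P :: "(real ^ 'd::finite) set"
  assumes int: "interior P \<noteq> {}" and F: "F facet_of P"
    and H: "w \<noteq> 0" "P \<subseteq> halfspace w c" "F \<subseteq> frontier (halfspace w c)"
    and H': "w' \<noteq> 0" "P \<subseteq> halfspace w' c'" "F \<subseteq> frontier (halfspace w' c')"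
  shows "halfspace w c = halfspace w' c'"
proof -
  have F_dim: "F \<noteq> {}" "aff_dim F = int DIM(real ^ 'd) - 1"
    using F aff_dim_nonempty_interior[OF int] by (auto simp: facet_of_def)
  have span: "affine hull F = {x. v \<bullet> x = b}"
    if "v \<noteq> 0" "F \<subseteq> frontier (halfspace v b)" for v :: "real ^ 'd" and b
  proof (rule affine_dim_equal)
    show "affine hull F \<subseteq> {x. v \<bullet> x = b}"
      using that by (intro hull_minimal) (auto simp: frontier_halfspace_ge affine_hyperplane)
    show "aff_dim (affine hull F) = aff_dim {x. v \<bullet> x = b}"
      using F_dim that(1) by (simp add: aff_dim_hyperplane)
  qed (use F_dim in \<open>auto simp: affine_hyperplane\<close>)
  have same: "{x. w \<bullet> x = c} = {x. w' \<bullet> x = c'}"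
    using span[OF H(1,3)] span[OF H'(1,3)] by simp
  obtain p where "p \<in> interior P"
    using int by blast
  then have "p \<in> interior (halfspace w c)" "p \<in> interior (halfspace w' c')"
    using interior_mono H(2) H'(2) by blast+
  then have "c < w \<bullet> p" "c' < w' \<bullet> p"
    using H(1) H'(1) by simp_all
  then show ?thesis
    using halfspace_subset_if_same_hyperplane[OF same]
      halfspace_subset_if_same_hyperplane[OF same[symmetric]] by blast
qed

lemma finite_facet_halfspaces:
  fixes P :: "(real ^ 'd::finite) set"
  assumes "polyhedron P" "interior P \<noteq> {}"
  shows "finite (facet_halfspaces P)"
proof -
  have "\<exists>\<phi>. \<forall>H\<in>facet_halfspaces P. \<phi> H facet_of P \<and> \<phi> H \<subseteq> frontier H"
    by (rule bchoice) (auto simp: facet_halfspaces_def)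
  then obtain \<phi> where \<phi>: "\<And>H. H \<in> facet_halfspaces P \<Longrightarrow> \<phi> H facet_of P \<and> \<phi> H \<subseteq> frontier H"
    by blast
  have "inj_on \<phi> (facet_halfspaces P)"
  proof (rule inj_onI)
    fix H H'
    assume H: "H \<in> facet_halfspaces P" and H': "H' \<in> facet_halfspaces P" and eq: "\<phi> H = \<phi> H'"
    obtain w c where w: "w \<noteq> 0" "H = halfspace w c" "P \<subseteq> H"
      using H unfolding facet_halfspaces_def by blast
    obtain w' c' where w': "w' \<noteq> 0" "H' = halfspace w' c'" "P \<subseteq> H'"
      using H' unfolding facet_halfspaces_def by blast
    show "H = H'"
      using facet_determines_halfspace[OF assms(2), of "\<phi> H" w c w' c'] \<phi>[OF H] \<phi>[OF H'] eq w w'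
      by simp
  qed
  moreover have "\<phi> ` facet_halfspaces P \<subseteq> {F. F facet_of P}"
    using \<phi> by blast
  ultimately show ?thesis
    using finite_polyhedron_facets[OF assms(1)] by (rule inj_on_finite)
qed


section \<open>Points of bounded encoding length\<close>

lemma finite_int_length_le: "finite {k. int_length k \<le> L}"
proof (rule finite_subset)
  show "{k. int_length k \<le> L} \<subseteq> {- (2 ^ L)..2 ^ L}"
  proof
    fix k assume "k \<in> {k. int_length k \<le> L}"
    then have "nat \<lceil>log 2 (real_of_int \<bar>k\<bar> + 1)\<rceil> \<le> L"
      unfolding int_length_def mem_Collect_eq by (rule add_leD2)
    then have "real (nat \<lceil>log 2 (real_of_int \<bar>k\<bar> + 1)\<rceil>) \<le> real L"
      by (simp only: of_nat_le_iff)
    then have "log 2 (real_of_int \<bar>k\<bar> + 1) \<le> real L"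
      by (rule order_trans[OF real_nat_ceiling_ge])
    then have "real_of_int \<bar>k\<bar> + 1 \<le> 2 powr real L"
      by (subst (asm) log_le_iff) auto
    also have "\<dots> = of_int (2 ^ L)"
      by (simp add: powr_realpow)
    finally show "k \<in> {- (2 ^ L)..2 ^ L}"
      by (simp only: atLeastAtMost_iff) linarith
  qed
qed simp

lemma finite_rat_length_le: "finite {r. rat_length r \<le> L}"
proof (rule finite_imageD)
  show "inj_on quotient_of {r. rat_length r \<le> L}"
    by (auto intro: inj_onI simp: quotient_of_inject)
  show "finite (quotient_of ` {r. rat_length r \<le> L})"
    by (rule finite_subset[OF _ finite_cartesian_product[OF
            finite_int_length_le[of L] finite_int_length_le[of L]]])
      (simp add: image_subset_iff mem_Times_iff rat_length_def)
qed

lemma finite_vec_length_le: "finite {q. vec_length q \<le> L}"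
proof (rule finite_subset)
  show "{q. vec_length q \<le> L} \<subseteq> vec_lambda ` (\<Pi>\<^sub>E j\<in>UNIV. {r. rat_length r \<le> L})"
  proof
    fix q :: "rat ^ 'n"
    assume "q \<in> {q. vec_length q \<le> L}"
    moreover have "rat_length (q $ j) \<le> vec_length q" for j
      unfolding vec_length_def by (rule member_le_sum) auto
    ultimately have "vec_nth q \<in> (\<Pi>\<^sub>E j\<in>UNIV. {r. rat_length r \<le> L})"
      by (auto intro: le_trans)
    then show "q \<in> vec_lambda ` (\<Pi>\<^sub>E j\<in>UNIV. {r. rat_length r \<le> L})"
      by (metis image_eqI vec_nth_inverse)
  qed
qed (simp add: finite_PiE finite_rat_length_le)

lemma finite_encoded_within: "finite {x :: real ^ 'n::finite. encoded_within x L}"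
proof -
  have "{x :: real ^ 'n. encoded_within x L} = (\<lambda>q. \<chi> j. of_rat (q $ j)) ` {q. vec_length q \<le> L}"
    by (auto simp: encoded_within_def)
  then show ?thesis
    by (simp add: finite_vec_length_le)
qed

lemma encoded_within_mono: "encoded_within x L \<Longrightarrow> L \<le> L' \<Longrightarrow> encoded_within x L'"
  by (auto simp: encoded_within_def intro: le_trans)


section \<open>Invariant of the algorithm\<close>

definition short_solutions ::
    "('d::finite, 'm::finite, 'n::finite) momilp \<Rightarrow> nat \<Rightarrow> (real ^ 'n) set" where
  "short_solutions I L = {x \<in> feasible_set I. encoded_within x L}"

lemma finite_short_solutions: "finite (short_solutions I L)"
  unfolding short_solutions_def
  by (rule finite_subset[OF _ finite_encoded_within[of L]]) auto

definition inner_approx ::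
    "('d::finite, 'm::finite, 'n::finite) momilp \<Rightarrow> (real ^ 'n) set \<Rightarrow> (real ^ 'd) set" where
  "inner_approx I R = convex hull (objective I ` R) + {0..}"

text \<open>
  The answer \<open>Inside\<close> for a shifted halfspace is recorded as a property of the confirmed halfspace
  itself, as a set, because the set \<open>F\<close> of a state does not retain the normal and the offset that
  were used in the query.
\<close>

definition ia_invariant ::
    "('d::finite, 'm::finite, 'n::finite) momilp \<Rightarrow> real \<Rightarrow> nat \<Rightarrow> ('d, 'n) state \<Rightarrow> bool" where
  "ia_invariant I \<epsilon> L = (\<lambda>(R, A, F).
     R \<noteq> {} \<and> R \<subseteq> short_solutions I L \<and> A = inner_approx I R \<and>
     (\<forall>H\<in>F. \<forall>x\<in>feasible_set I. (1 + \<epsilon>) *\<^sub>R objective I x \<in> H))"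

lemma polyhedron_inner_approx: "finite R \<Longrightarrow> polyhedron (inner_approx I R)"
  unfolding inner_approx_def by (simp add: polyhedron_convex_hull_plus_orthant)

lemma interior_inner_approx_nonempty: "R \<noteq> {} \<Longrightarrow> interior (inner_approx I R) \<noteq> {}"
  unfolding inner_approx_def by (simp add: interior_plus_orthant_nonempty)

lemma objective_mem_inner_approx: "x \<in> R \<Longrightarrow> objective I x \<in> inner_approx I R"
  unfolding inner_approx_def
  using set_plus_intro[of "objective I x" "convex hull (objective I ` R)" 0 "{0..}"]
  by (simp add: hull_inc)

lemma scaled_normal_nonneg:
  assumes "R \<noteq> {}" "0 < \<epsilon>" "w \<noteq> 0" "halfspace w c \<in> facet_halfspaces (inner_approx I R)"
  shows "(1 + \<epsilon>) *\<^sub>R w \<noteq> 0" and "0 \<le> (1 + \<epsilon>) *\<^sub>R w"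
proof -
  have "inner_approx I R \<subseteq> halfspace w c"
    using assms(4) by (auto simp: facet_halfspaces_def)
  then have "0 \<le> w"
    unfolding inner_approx_def
    by (rule normal_nonneg_if_plus_orthant_subset_halfspace[rotated]) (simp add: assms(1))
  then show "0 \<le> (1 + \<epsilon>) *\<^sub>R w"
    using assms(2) by (simp add: scaleR_nonneg_nonneg)
  show "(1 + \<epsilon>) *\<^sub>R w \<noteq> 0"
    using assms(2,3) by simp
qed

text \<open>
  Because \<open>w\<close> and the image of \<open>x\<close> are nonnegative, violating the shifted halfspace implies
  violating the original one, which contains the images of all members of \<open>R\<close>.
\<close>

lemma oracle_not_inside:
  assumes orc: "plane_separating_oracle p I hpO" and pos: "image_set I \<subseteq> {0..}" "0 < \<epsilon>"
    and R: "R \<noteq> {}" and w: "w \<noteq> 0" "halfspace w c \<in> facet_halfspaces (inner_approx I R)"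
    and ans: "hpO (halfspace ((1 + \<epsilon>) *\<^sub>R w) c) = Not_Inside x"
  shows "x \<in> short_solutions I (poly p (inst_length I))" and "x \<notin> R"
proof -
  note nonneg = scaled_normal_nonneg[OF R pos(2) w]
  have x: "x \<in> feasible_set I" "encoded_within x (poly p (inst_length I))"
      "objective I x \<notin> halfspace ((1 + \<epsilon>) *\<^sub>R w) c"
    using orc[unfolded plane_separating_oracle_def, rule_format, OF nonneg, of c] ans by simp_all
  then show "x \<in> short_solutions I (poly p (inst_length I))"
    by (simp add: short_solutions_def)
  have "0 \<le> objective I x"
    using x(1) pos(1) by (auto simp: image_set_def)
  then have "0 \<le> ((1 + \<epsilon>) *\<^sub>R w) \<bullet> objective I x"
    using nonneg(2) by (auto simp: inner_vec_def less_eq_vec_def intro!: sum_nonneg)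
  then have "0 \<le> w \<bullet> objective I x"
    using pos(2) by (simp add: zero_le_mult_iff)
  then have "w \<bullet> objective I x \<le> (1 + \<epsilon>) * (w \<bullet> objective I x)"
    using pos(2) by (simp add: algebra_simps)
  then have "objective I x \<notin> halfspace w c"
    using x(3) by simp
  then show "x \<notin> R"
    using w(2) objective_mem_inner_approx[of x R I] by (auto simp: facet_halfspaces_def)
qed

lemma oracle_inside:
  assumes orc: "plane_separating_oracle p I hpO" and pos: "0 < \<epsilon>"
    and R: "R \<noteq> {}" and w: "w \<noteq> 0" "halfspace w c \<in> facet_halfspaces (inner_approx I R)"
    and ans: "hpO (halfspace ((1 + \<epsilon>) *\<^sub>R w) c) = Inside" and x: "x \<in> feasible_set I"
  shows "(1 + \<epsilon>) *\<^sub>R objective I x \<in> halfspace w c"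
  using orc[unfolded plane_separating_oracle_def, rule_format,
      OF scaled_normal_nonneg[OF R pos w], of c] ans x by simp

lemma ia_invariant_init:
  assumes "xinit \<in> feasible_set I" "encoded_within xinit L"
  shows "ia_invariant I \<epsilon> L (ia_init I xinit)"
  using assms by (simp add: ia_invariant_def ia_init_def short_solutions_def inner_approx_def)

lemma ia_invariant_step:
  assumes orc: "plane_separating_oracle p I hpO" and pos: "image_set I \<subseteq> {0..}" "0 < \<epsilon>"
    and L: "poly p (inst_length I) \<le> L"
    and step: "ia_step I \<epsilon> hpO s s'" and inv: "ia_invariant I \<epsilon> L s"
  shows "ia_invariant I \<epsilon> L s'"
  using step
proof cases
  case (add_solution w c A F x R)
  have R: "R \<noteq> {}" and A: "A = inner_approx I R"
    using inv add_solution(1) by (auto simp: ia_invariant_def)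
  have "x \<in> short_solutions I (poly p (inst_length I))"
    using oracle_not_inside(1)[OF orc pos R] add_solution A by blast
  then have "x \<in> short_solutions I L"
    using encoded_within_mono[OF _ L] by (auto simp: short_solutions_def)
  then show ?thesis
    using inv add_solution(1,2) by (auto simp: ia_invariant_def inner_approx_def)
next
  case (confirm_halfspace w c A F R)
  have R: "R \<noteq> {}" and A: "A = inner_approx I R"
    using inv confirm_halfspace(1) by (auto simp: ia_invariant_def)
  have "\<forall>x\<in>feasible_set I. (1 + \<epsilon>) *\<^sub>R objective I x \<in> halfspace w c"
    using oracle_inside[OF orc pos(2) R] confirm_halfspace A by blast
  then show ?thesis
    using inv confirm_halfspace(1,2) by (auto simp: ia_invariant_def)
qed

lemma ia_invariant_steps:
  assumes "plane_separating_oracle p I hpO" "image_set I \<subseteq> {0..}" "0 < \<epsilon>"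
    and "poly p (inst_length I) \<le> L"
    and "(ia_step I \<epsilon> hpO)\<^sup>*\<^sup>* s s'" "ia_invariant I \<epsilon> L s"
  shows "ia_invariant I \<epsilon> L s'"
  using assms(5,6) by induction (auto intro: ia_invariant_step[OF assms(1-4)])


section \<open>Termination and approximation quality\<close>

definition ia_rank ::
    "('d::finite, 'm::finite, 'n::finite) momilp \<Rightarrow> nat \<Rightarrow> ('d, 'n) state \<Rightarrow> nat \<times> nat" where
  "ia_rank I L = (\<lambda>(R, A, F). (card (short_solutions I L - R), card (facet_halfspaces A - F)))"

text \<open>
  Adding a solution may create many unconfirmed facets, but it decreases the number of short
  solutions outside \<open>R\<close>; this is why the rank is lexicographic.
\<close>

lemma ia_rank_decreases:
  assumes orc: "plane_separating_oracle p I hpO" and pos: "image_set I \<subseteq> {0..}" "0 < \<epsilon>"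
    and L: "poly p (inst_length I) \<le> L"
    and step: "ia_step I \<epsilon> hpO s s'" and inv: "ia_invariant I \<epsilon> L s"
  shows "(ia_rank I L s', ia_rank I L s) \<in> less_than <*lex*> less_than"
  using step
proof cases
  case (add_solution w c A F x R)
  have R: "R \<noteq> {}" and A: "A = inner_approx I R"
    using inv add_solution(1) by (auto simp: ia_invariant_def)
  have "x \<notin> R"
    using oracle_not_inside(2)[OF orc pos R] add_solution A by blast
  moreover have "x \<in> short_solutions I L"
    using ia_invariant_step[OF assms] add_solution(2) by (auto simp: ia_invariant_def)
  ultimately have "short_solutions I L - insert x R \<subset> short_solutions I L - R"
    by blast
  then have "card (short_solutions I L - insert x R) < card (short_solutions I L - R)"
    by (simp add: psubset_card_mono finite_short_solutions)
  then show ?thesis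
    by (simp add: ia_rank_def add_solution(1,2))
next
  case (confirm_halfspace w c A F R)
  have R: "R \<noteq> {}" "R \<subseteq> short_solutions I L" and A: "A = inner_approx I R"
    using inv confirm_halfspace(1) by (auto simp: ia_invariant_def)
  have "finite R"
    using R(2) finite_short_solutions by (rule finite_subset)
  then have "finite (facet_halfspaces A)"
    unfolding A by (intro finite_facet_halfspaces polyhedron_inner_approx
        interior_inner_approx_nonempty R(1))
  moreover have "facet_halfspaces A - insert (halfspace w c) F \<subset> facet_halfspaces A - F"
    using confirm_halfspace(4) by blast
  ultimately have
    "card (facet_halfspaces A - insert (halfspace w c) F) < card (facet_halfspaces A - F)"
    by (simp add: psubset_card_mono)
  then show ?thesis
    by (simp add: ia_rank_def confirm_halfspace(1,2))
qed

lemma inner_approximation_terminates: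
  assumes "plane_separating_oracle p I hpO" "image_set I \<subseteq> {0..}" "0 < \<epsilon>"
    and "poly p (inst_length I) \<le> L" and "ia_invariant I \<epsilon> L (ia_init I xinit)"
  shows "ia_terminates I \<epsilon> hpO xinit"
  unfolding ia_terminates_def
proof
  assume "\<exists>s. s 0 = ia_init I xinit \<and> (\<forall>i::nat. ia_step I \<epsilon> hpO (s i) (s (Suc i)))"
  then obtain s where s0: "s 0 = ia_init I xinit"
      and s: "\<And>i::nat. ia_step I \<epsilon> hpO (s i) (s (Suc i))"
    by blast
  have inv: "ia_invariant I \<epsilon> L (s i)" for i
    by (induction i) (use assms(5) s0 ia_invariant_step[OF assms(1-4) s] in auto)
  have "(ia_rank I L (s (Suc i)), ia_rank I L (s i)) \<in> less_than <*lex*> less_than" for i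
    using ia_rank_decreases[OF assms(1-4) s inv] .
  then have "\<exists>r. \<forall>i. (r (Suc i), r i) \<in> less_than <*lex*> less_than"
    by (intro exI[of _ "\<lambda>i. ia_rank I L (s i)"] allI)
  moreover have "wf (less_than <*lex*> less_than)"
    by (simp add: wf_lex_prod)
  ultimately show False
    unfolding wf_iff_no_infinite_down_chain by blast
qed

lemma final_state_convex_approx_set:
  assumes inv: "ia_invariant I \<epsilon> L (R, A, F)" and final: "facet_halfspaces A - F = {}"
  shows "convex_approx_set I \<epsilon> R"
  unfolding convex_approx_set_def
proof (intro conjI ballI)
  have R: "R \<noteq> {}" "R \<subseteq> short_solutions I L" and A: "A = inner_approx I R"
    and F: "\<And>H x. H \<in> F \<Longrightarrow> x \<in> feasible_set I \<Longrightarrow> (1 + \<epsilon>) *\<^sub>R objective I x \<in> H"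
    using inv by (auto simp: ia_invariant_def)
  show "R \<subseteq> feasible_set I"
    using R(2) by (auto simp: short_solutions_def)
  fix x assume x: "x \<in> feasible_set I"
  have "finite R"
    using R(2) finite_short_solutions by (rule finite_subset)
  then have "\<Inter>(facet_halfspaces A) \<subseteq> A"
    unfolding A by (intro Inter_facet_halfspaces_subset polyhedron_inner_approx
        interior_inner_approx_nonempty R(1))
  then have "(1 + \<epsilon>) *\<^sub>R objective I x \<in> A"
    using F x final by blast
  then obtain v y where v: "v \<in> convex hull (objective I ` R)" and "0 \<le> y"
      "(1 + \<epsilon>) *\<^sub>R objective I x = v + y"
    unfolding A inner_approx_def by (auto elim: set_plus_elim)
  then have "v \<le> (1 + \<epsilon>) *\<^sub>R objective I x"
    by simp
  then show "\<exists>v\<in>convex hull (objective I ` R). v \<le> (1 + \<epsilon>) *\<^sub>R objective I x"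
    using v by blast
qed

theorem theorem3:
  fixes I :: "('d::finite, 'm::finite, 'n::finite) momilp"
    and \<epsilon> :: real
    and hpO :: "(real ^ 'd) set \<Rightarrow> 'n answer"
    and xinit :: "real ^ 'n"
    and p q :: "nat poly"
  assumes "feasible_set I \<noteq> {}"
    and "image_set I \<subseteq> {0..}"
    and "\<epsilon> > 0"
    and "plane_separating_oracle p I hpO"
    and "xinit \<in> feasible_set I"
    and "encoded_within xinit (poly q (inst_length I))"
  shows "ia_terminates I \<epsilon> hpO xinit \<and>
    (\<forall>R. ia_computes I \<epsilon> hpO xinit R \<longrightarrow> convex_approx_set I \<epsilon> R)"
proof -
  define L where "L = max (poly p (inst_length I)) (poly q (inst_length I))"
  have L: "poly p (inst_length I) \<le> L"
    by (simp add: L_def)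
  have init: "ia_invariant I \<epsilon> L (ia_init I xinit)"
    using assms(5) by (rule ia_invariant_init)
      (rule encoded_within_mono[OF assms(6)], simp add: L_def)
  have "convex_approx_set I \<epsilon> R" if "ia_computes I \<epsilon> hpO xinit R" for R
    using that unfolding ia_computes_def
    by (auto intro: final_state_convex_approx_set
        ia_invariant_steps[OF assms(4,2,3) L _ init])
  then show ?thesis
    using inner_approximation_terminates[OF assms(4,2,3) L init] by blast
qed

end
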